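(* Let $k \geq 3$ and let $a_1 \leq a_2 \leq \dots \leq a_k$ be positive integers. The complete $k$-partite graph $K_{a_1,a_2,\dots,a_k}$ is a TRVG if and only if $a_{k-1} \leq 2$ or $(a_{k-2},a_{k-1},a_k) \in \{(1,3,3),(1,3,4),(2,3,3),(2,3,4)\}$.
   Context: A (finite, simple) graph $G$ is a transparent rectangle visibility graph (TRVG) if there is an assignment of a rectangle $R_v$ in the plane to each vertex $v$, where each $R_v$ is a nondegenerate closed rectangle with sides parallel to the coordinate axes and distinct rectangles have disjoint interiors, such that for all distinct vertices $u,v$: $u$ and $v$ are adjacent if and only if there is a horizontal line or a vertical line meeting the interiors of both $R_u$ and $R_v$. $K_{a_1,\dots,a_k}$ denotes the complete $k$-partite graph with parts of sizes $a_1,\dots,a_k$. *)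

theory Defs
  imports "HOL-Analysis.Analysis" "Graph_Theory.Pair_Digraph"
begin

text \<open>
  Finite simple graphs are given by the locale \<open>pair_graph\<close>: a finite vertex set
  together with a symmetric and irreflexive set of vertex pairs.
\<close>

definition axis_rectangle :: "(real \<times> real) set \<Rightarrow> bool" where
  "axis_rectangle R \<longleftrightarrow>
     (\<exists>x1 x2 y1 y2. x1 < x2 \<and> y1 < y2 \<and> R = {x1..x2} \<times> {y1..y2})"

definition horizontal_line :: "(real \<times> real) set \<Rightarrow> bool" where
  "horizontal_line L \<longleftrightarrow> (\<exists>c. L = {p. snd p = c})"

definition vertical_line :: "(real \<times> real) set \<Rightarrow> bool" where
  "vertical_line L \<longleftrightarrow> (\<exists>c. L = {p. fst p = c})"

text \<open>
  Visibility is transparent: rectangles lying between the two given ones do not block the line.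
\<close>

definition sees :: "(real \<times> real) set \<Rightarrow> (real \<times> real) set \<Rightarrow> bool" where
  "sees R S \<longleftrightarrow>
     (\<exists>L. (horizontal_line L \<or> vertical_line L) \<and>
          L \<inter> interior R \<noteq> {} \<and> L \<inter> interior S \<noteq> {})"

definition trv_representation ::
    "'v pair_pre_digraph \<Rightarrow> ('v \<Rightarrow> (real \<times> real) set) \<Rightarrow> bool" where
  "trv_representation G R \<longleftrightarrow>
     (\<forall>v \<in> pverts G. axis_rectangle (R v)) \<and>
     (\<forall>u \<in> pverts G. \<forall>v \<in> pverts G. u \<noteq> v \<longrightarrow>
        interior (R u) \<inter> interior (R v) = {}) \<and>
     (\<forall>u \<in> pverts G. \<forall>v \<in> pverts G. u \<noteq> v \<longrightarrow>
        ((u, v) \<in> parcs G \<longleftrightarrow> sees (R u) (R v)))"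

definition TRVG :: "'v pair_pre_digraph \<Rightarrow> bool" where
  "TRVG G \<longleftrightarrow> pair_graph G \<and> (\<exists>R. trv_representation G R)"

text \<open>
  The vertex \<open>(i, j)\<close> is the \<open>j\<close>-th vertex of the \<open>i\<close>-th part;
  only the values \<open>a 1, \<dots>, a k\<close> matter.
\<close>

definition complete_multipartite :: "nat \<Rightarrow> (nat \<Rightarrow> nat) \<Rightarrow> (nat \<times> nat) pair_pre_digraph" where
  "complete_multipartite k a =
     (let V = (SIGMA i : {1..k}. {1..a i})
      in \<lparr> pverts = V, parcs = {(u, v). u \<in> V \<and> v \<in> V \<and> fst u \<noteq> fst v} \<rparr>)"

lemma pair_graph_complete_multipartite: "pair_graph (complete_multipartite k a)"
proof -
  let ?V = "SIGMA i : {1..k}. {1..a i}"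
  have "finite ?V" by auto
  moreover have "{(u, v). u \<in> ?V \<and> v \<in> ?V \<and> fst u \<noteq> fst v} \<subseteq> ?V \<times> ?V" by auto
  ultimately have "finite {(u, v). u \<in> ?V \<and> v \<in> ?V \<and> fst u \<noteq> fst v}"
    by (meson finite_SigmaI finite_subset)
  then show ?thesis
    unfolding complete_multipartite_def Let_def
    by unfold_locales (auto simp: symmetric_def arcs_ends_def arc_to_ends_def with_proj_def
        intro!: symI)
qed

end

theory Submission
  imports Defs
begin

text \<open>
  A transparent rectangle representation amounts to two families of open intervals, the projections
  to the axes, such that adjacent vertices overlap in exactly one of the two families and nonadjacent
  ones in neither. So the graph must be decomposed into two edge-disjoint interval graphs.

  Between two parts of sizes \<open>m\<close> and \<open>n\<close> each of the two interval graphs is a forest, so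
  \<open>m n \<le> 2 (m + n - 1)\<close>; with \<open>3 \<le> m \<le> n\<close> this leaves only \<open>(3, 3)\<close> and \<open>(3, 4)\<close>.
  The graph \<open>K\<^sub>3\<^sub>,\<^sub>3\<^sub>,\<^sub>3\<close> is excluded because interval graphs have no induced cycles of
  length 4, 5 or 6: a case distinction on the decomposition of \<open>K\<^sub>3\<^sub>,\<^sub>3\<close> between two parts
  restricts the neighbourhoods of the vertices of the third part so much that two of them span
  a forbidden cycle.

  Conversely, any representable graph can be joined with arbitrarily many parts of size at most 2,
  and both an independent set and \<open>K\<^sub>3\<^sub>,\<^sub>4\<close> are representable.
\<close>

section \<open>Interval graphs\<close>

text \<open>The strict inequalities match interiors of rectangles: for nonempty intervals they say
  that the open intervals from \<open>l\<close> to \<open>r\<close> meet, so touching ends do not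
  count.\<close>

definition overlap :: "('v \<Rightarrow> real) \<Rightarrow> ('v \<Rightarrow> real) \<Rightarrow> 'v \<Rightarrow> 'v \<Rightarrow> bool" where
  "overlap l r u v \<longleftrightarrow> l u < r v \<and> l v < r u"

definition interval_rel :: "('v \<Rightarrow> 'v \<Rightarrow> bool) \<Rightarrow> bool" where
  "interval_rel X \<longleftrightarrow> (\<exists>l r. X = overlap l r)"

lemma interval_rel_sym:
  fixes X :: "'v \<Rightarrow> 'v \<Rightarrow> bool"
  shows "interval_rel X \<Longrightarrow> X u v \<longleftrightarrow> X v u"
  by (auto simp: interval_rel_def overlap_def)

text \<open>The neighbours of a vertex whose interval ends first all contain points just before this end.
  In an induced cycle this yields a chord.\<close>

lemma interval_rel_simplicial:
  fixes X :: "'v \<Rightarrow> 'v \<Rightarrow> bool"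
  assumes "interval_rel X"
  obtains r :: "'v \<Rightarrow> real"
  where "\<And>u v w. X u v \<Longrightarrow> X u w \<Longrightarrow> r u \<le> r v \<Longrightarrow> r u \<le> r w \<Longrightarrow> X v w"
proof -
  obtain l r where "X = overlap l r"
    using assms by (auto simp: interval_rel_def)
  then show ?thesis
    by (intro that[of r]) (auto simp: overlap_def)
qed

lemma interval_rel_C4:
  assumes "interval_rel X" "X u v" "X v w" "X w z" "X z u"
  shows "X u w \<or> X v z"
proof -
  note sym = interval_rel_sym[OF assms(1)]
  obtain r :: "_ \<Rightarrow> real" where r: "\<And>u v w. X u v \<Longrightarrow> X u w \<Longrightarrow> r u \<le> r v \<Longrightarrow> r u \<le> r w \<Longrightarrow> X v w"
    using interval_rel_simplicial[OF assms(1)] by blast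
  show ?thesis
    \<comment> \<open>One instance per vertex of the cycle covers every candidate for the least
      \<open>r\<close>.\<close>
    using r[of u z v] r[of v u w] r[of w v z] r[of z w u]
      sym[of u z] sym[of v u] sym[of w v] sym[of z w] sym[of w u] sym[of z v] assms(2-)
    by argo
qed

lemma interval_rel_C5:
  assumes "interval_rel X" "X u v" "X v w" "X w z" "X z t" "X t u"
  shows "X u w \<or> X v z \<or> X w t \<or> X z u \<or> X t v"
proof -
  note sym = interval_rel_sym[OF assms(1)]
  obtain r :: "_ \<Rightarrow> real" where r: "\<And>u v w. X u v \<Longrightarrow> X u w \<Longrightarrow> r u \<le> r v \<Longrightarrow> r u \<le> r w \<Longrightarrow> X v w"
    using interval_rel_simplicial[OF assms(1)] by blast
  show ?thesis
    using r[of u t v] r[of v u w] r[of w v z] r[of z w t] r[of t z u]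
      sym[of u t] sym[of v u] sym[of w v] sym[of z w] sym[of t z] assms(2-)
    by argo
qed

lemma interval_rel_C6:
  assumes "interval_rel X" "X u v" "X v w" "X w z" "X z t" "X t s" "X s u"
  shows "X u w \<or> X v z \<or> X w t \<or> X z s \<or> X t u \<or> X s v"
proof -
  note sym = interval_rel_sym[OF assms(1)]
  obtain r :: "_ \<Rightarrow> real" where r: "\<And>u v w. X u v \<Longrightarrow> X u w \<Longrightarrow> r u \<le> r v \<Longrightarrow> r u \<le> r w \<Longrightarrow> X v w"
    using interval_rel_simplicial[OF assms(1)] by blast
  show ?thesis
    using r[of u s v] r[of v u w] r[of w v z] r[of z w t] r[of t z s] r[of s t u]
      sym[of u s] sym[of v u] sym[of w v] sym[of z w] sym[of t z] sym[of s t] assms(2-)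
    by argo
qed

section \<open>Decompositions of complete multipartite graphs\<close>

definition multipartite_split ::
    "'v set \<Rightarrow> ('v \<Rightarrow> 'p) \<Rightarrow> ('v \<Rightarrow> 'v \<Rightarrow> bool) \<Rightarrow> ('v \<Rightarrow> 'v \<Rightarrow> bool) \<Rightarrow> bool" where
  "multipartite_split V p X Y \<longleftrightarrow> interval_rel X \<and> interval_rel Y \<and>
     (\<forall>u\<in>V. \<forall>v\<in>V. p u \<noteq> p v \<longrightarrow> (Y u v \<longleftrightarrow> \<not> X u v)) \<and>
     (\<forall>u\<in>V. \<forall>v\<in>V. u \<noteq> v \<and> p u = p v \<longrightarrow> \<not> X u v \<and> \<not> Y u v)"

lemma multipartite_split_swap: "multipartite_split V p X Y \<Longrightarrow> multipartite_split V p Y X"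
  by (auto simp: multipartite_split_def)

lemma multipartite_split_mono:
  "multipartite_split W p X Y \<Longrightarrow> V \<subseteq> W \<Longrightarrow> multipartite_split V p X Y"
  by (simp add: multipartite_split_def subset_iff)

section \<open>Excluding three parts of size 3\<close>

locale split_K33 =
  fixes V :: "'v set" and p :: "'v \<Rightarrow> 'p" and X Y :: "'v \<Rightarrow> 'v \<Rightarrow> bool"
    and a0 a1 a2 b0 b1 b2 :: 'v
  assumes split: "multipartite_split V p X Y"
    and verts: "{a0, a1, a2, b0, b1, b2} \<subseteq> V"
    and distinct: "distinct [a0, a1, a2, b0, b1, b2]"
    and parts: "p a1 = p a0" "p a2 = p a0" "p b1 = p b0" "p b2 = p b0" "p a0 \<noteq> p b0"
begin

lemma iX: "interval_rel X" and iY: "interval_rel Y"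
  using split by (auto simp: multipartite_split_def)

lemmas sX = interval_rel_sym[OF iX] and sY = interval_rel_sym[OF iY]

lemmas X4 = interval_rel_C4[OF iX] and X5 = interval_rel_C5[OF iX] and X6 = interval_rel_C6[OF iX]
  and Y4 = interval_rel_C4[OF iY] and Y5 = interval_rel_C5[OF iY]

lemma cross: "u \<in> V \<Longrightarrow> v \<in> V \<Longrightarrow> p u \<noteq> p v \<Longrightarrow> Y u v \<longleftrightarrow> \<not> X u v"
  using split by (auto simp: multipartite_split_def)

lemma same: "u \<in> V \<Longrightarrow> v \<in> V \<Longrightarrow> p u = p v \<Longrightarrow> u \<noteq> v \<Longrightarrow> \<not> X u v \<and> \<not> Y u v"
  using split by (auto simp: multipartite_split_def)

lemma neq: "a0 \<noteq> a1" "a0 \<noteq> a2" "a1 \<noteq> a2" "b0 \<noteq> b1" "b0 \<noteq> b2" "b1 \<noteq> b2"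
  using distinct by auto

lemmas neqs = neq neq[symmetric]

lemma within:
  "u \<in> {a0, a1, a2} \<Longrightarrow> v \<in> {a0, a1, a2} \<Longrightarrow> u \<noteq> v \<Longrightarrow> \<not> X u v \<and> \<not> Y u v"
  "u \<in> {b0, b1, b2} \<Longrightarrow> v \<in> {b0, b1, b2} \<Longrightarrow> u \<noteq> v \<Longrightarrow> \<not> X u v \<and> \<not> Y u v"
  using verts parts by (intro same; auto)+

text \<open>As rewrite rules these eliminate \<open>Y\<close> and orient each pair from an
  \<open>a\<close> to a \<open>b\<close>; \<open>outside\<close> does the same for a third
  part.\<close>

lemma across:
  assumes "u \<in> {a0, a1, a2}" "v \<in> {b0, b1, b2}"
  shows "X v u \<longleftrightarrow> X u v" "Y v u \<longleftrightarrow> \<not> X u v" "Y u v \<longleftrightarrow> \<not> X u v"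
  using cross[of u v] sX[of v u] sY[of v u] assms verts parts by auto

lemma outside:
  assumes "c \<in> V" "p c \<notin> {p a0, p b0}" "v \<in> {a0, a1, a2, b0, b1, b2}"
  shows "X v c \<longleftrightarrow> X c v" "Y v c \<longleftrightarrow> \<not> X c v" "Y c v \<longleftrightarrow> \<not> X c v"
proof -
  have "v \<in> V" "p c \<noteq> p v"
    using assms verts parts by auto
  then show "X v c \<longleftrightarrow> X c v" "Y v c \<longleftrightarrow> \<not> X c v" "Y c v \<longleftrightarrow> \<not> X c v"
    using cross[of c v] sX[of v c] sY[of v c] assms(1) by auto
qed

text \<open>Two symmetries of the hypotheses: exchanging the parts, and exchanging \<open>a0\<close>
  with \<open>a1\<close> and \<open>b1\<close> with \<open>b2\<close>, which reverses the path
  \<open>b1, a0, b0, a1, b2\<close>.\<close>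

lemma permute:
  "split_K33 V p X Y b0 b1 b2 a0 a1 a2"
  "split_K33 V p X Y a1 a0 a2 b0 b2 b1"
  using split verts distinct parts by (auto simp: split_K33_def)

text \<open>Otherwise \<open>c, u, c', v\<close> is a chordless 4-cycle, of \<open>X\<close> in the
  first claim and of \<open>Y\<close> in the second, where not being an \<open>X\<close>-neighbour
  of \<open>c\<close> means being a \<open>Y\<close>-neighbour.\<close>

lemma common_neighbours:
  assumes c: "c \<in> V" "c' \<in> V" "c \<noteq> c'" "p c = p c'" "p c \<notin> {p a0, p b0}"
    and uv: "u \<in> {a0, a1, a2, b0, b1, b2}" "v \<in> {a0, a1, a2, b0, b1, b2}"
  shows "\<not> X u v \<Longrightarrow> \<not> (X c u \<and> X c v \<and> X c' u \<and> X c' v)"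
    "\<not> Y u v \<Longrightarrow> X c u \<or> X c v \<or> X c' u \<or> X c' v"
proof -
  have "\<not> X c c'" "\<not> Y c c'"
    using same[OF c(1,2,4,3)] by simp_all
  moreover have c': "p c' \<notin> {p a0, p b0}"
    using c by simp
  note out = outside[OF c(1,5) uv(1)] outside[OF c(1,5) uv(2)]
    outside[OF c(2) c' uv(1)] outside[OF c(2) c' uv(2)]
  ultimately show "\<not> X u v \<Longrightarrow> \<not> (X c u \<and> X c v \<and> X c' u \<and> X c' v)"
    "\<not> Y u v \<Longrightarrow> X c u \<or> X c v \<or> X c' u \<or> X c' v"
    using X4[of c u c' v] Y4[of c u c' v] unfolding out by blast+
qed

text \<open>The first pattern: \<open>X\<close> is the path \<open>b1, a0, b0, a1, b2\<close> with \<open>a2\<close> attached to its centre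
  \<open>b0\<close>, and \<open>Y\<close> is the path \<open>a0, b2, a2, b1, a1\<close>. A vertex of the third part has both \<open>a0\<close> and
  \<open>a1\<close> as \<open>X\<close>-neighbours or both \<open>b1\<close> and \<open>b2\<close> as \<open>Y\<close>-neighbours, and no two vertices of that
  part may agree in this.\<close>

lemma star_half:
  assumes ab: "X a0 b0" "X a0 b1" "\<not> X a0 b2" "X a1 b0" "\<not> X a1 b1" "X a1 b2"
      "X a2 b0" "\<not> X a2 b1" "\<not> X a2 b2"
    and c: "c \<in> V" "p c \<notin> {p a0, p b0}" "\<not> X c a0"
  shows "\<not> X c b1 \<and> \<not> X c b2"
proof -
  \<comment> \<open>With the known adjacencies as rewrite rules, each instance of \<open>X4\<close>,
    \<open>X5\<close>, \<open>Y4\<close> or \<open>Y5\<close> names a cycle whose chords are all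
    excluded, so one of its edges must be missing.\<close>
  note [simp] = within across neqs outside[OF c(1,2)] ab c(3)
  have b1: "\<not> X c b1"
  proof
    assume b1 [simp]: "X c b1"
    have [simp]: "\<not> X c b0"
      using X4[of c b1 a0 b0] by auto
    have [simp]: "\<not> X c a1" "\<not> X c a2"
      using X5[of c b1 a0 b0 a1] X5[of c b1 a0 b0 a2] by auto
    show False
      using Y4[of c a1 b1 a2] by auto
  qed
  have "\<not> X c b2"
  proof
    assume [simp]: "X c b2"
    have [simp]: "\<not> X c a2"
      using Y5[of c a0 b2 a2 b1] b1 by auto
    show False
      using Y4[of c a0 b2 a2] by auto
  qed
  with b1 show ?thesis ..
qed

lemma star_pattern:
  assumes ab: "X a0 b0" "X a0 b1" "\<not> X a0 b2" "X a1 b0" "\<not> X a1 b1" "X a1 b2"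
      "X a2 b0" "\<not> X a2 b1" "\<not> X a2 b2"
    and c: "{c0, c1, c2} \<subseteq> V" "distinct [c0, c1, c2]" "p c1 = p c0" "p c2 = p c0"
      "p c0 \<notin> {p a0, p b0}"
  shows False
proof -
  have *: "X c a0 \<and> X c a1 \<or> \<not> X c b1 \<and> \<not> X c b2" if "c \<in> {c0, c1, c2}" for c
  proof -
    have "c \<in> V" "p c \<notin> {p a0, p b0}"
      using that c by auto
    then show ?thesis
      using star_half[OF ab, of c]
        split_K33.star_half[OF permute(2) ab(4,6,5,1,3,2,7,9,8), of c] parts by auto
  qed
  have cn: "\<not> (X c a0 \<and> X c a1 \<and> X c' a0 \<and> X c' a1)" "X c b1 \<or> X c b2 \<or> X c' b1 \<or> X c' b2"
    if "(c, c') \<in> {(c0, c1), (c0, c2), (c1, c2)}" for c c'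
  proof -
    have cc: "c \<in> V" "c' \<in> V" "c \<noteq> c'" "p c = p c'" "p c \<notin> {p a0, p b0}"
      using that c by auto
    show "\<not> (X c a0 \<and> X c a1 \<and> X c' a0 \<and> X c' a1)" "X c b1 \<or> X c b2 \<or> X c' b1 \<or> X c' b2"
      using common_neighbours(1)[OF cc, of a0 a1] common_neighbours(2)[OF cc, of b1 b2] within neqs
      by simp_all
  qed
  \<comment> \<open>Pigeonhole: two of the three vertices satisfy the same alternative of
    \<open>*\<close>, against \<open>cn\<close>.\<close>
  show False
    using *[of c0, simplified] *[of c1, simplified] *[of c2, simplified]
      cn[of c0 c1, simplified] cn[of c0 c2, simplified] cn[of c1 c2, simplified]
    by argo
qed

text \<open>The second pattern: \<open>X\<close> is the path \<open>a2, b1, a0, b0, a1, b2\<close>, and \<open>Y\<close> consists of the path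
  \<open>a0, b2, a2, b0\<close> and the edge \<open>a1 b1\<close>. Reversing the \<open>X\<close>-path exchanges the two parts.\<close>

lemma path_half:
  assumes ab: "X a0 b0" "X a0 b1" "\<not> X a0 b2" "X a1 b0" "\<not> X a1 b1" "X a1 b2"
      "\<not> X a2 b0" "X a2 b1" "\<not> X a2 b2"
    and c: "c \<in> V" "p c \<notin> {p a0, p b0}"
  shows "X c a2 \<Longrightarrow> X c b0 \<and> X c b1" "X c a0 \<Longrightarrow> X c a1 \<Longrightarrow> X c b0"
    "X c a1 \<Longrightarrow> X c b1 \<Longrightarrow> X c a0 \<or> X c b0"
proof -
  note [simp] = within across neqs outside[OF c(1,2)] ab
  show a0a1: "X c b0" if "X c a0" "X c a1"
    using X4[of c a0 b0 a1] that by auto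
  show "X c a0 \<or> X c b0" if "X c a1" "X c b1"
    using X5[of c b1 a0 b0 a1] that by auto
  assume [simp]: "X c a2"
  have b1: "X c b1"
  proof (rule ccontr)
    assume [simp]: "\<not> X c b1"
    have [simp]: "\<not> X c a0"
      using X4[of c a2 b1 a0] by auto
    have [simp]: "\<not> X c b0"
      using X5[of c a2 b1 a0 b0] by auto
    have [simp]: "\<not> X c b2"
      using Y5[of c a0 b2 a2 b0] by auto
    show False
      using Y4[of c b2 a2 b0] by auto
  qed
  have "X c b0"
  proof (rule ccontr)
    assume [simp]: "\<not> X c b0"
    have [simp]: "X c b2"
      using Y4[of c b2 a2 b0] by auto
    have [simp]: "X c a0"
      using Y5[of c a0 b2 a2 b0] by auto
    have "X c a1"
      using X5[of c a0 b0 a1 b2] by auto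
    then show False
      using a0a1 by simp
  qed
  with b1 show "X c b0 \<and> X c b1"
    by simp
qed

lemma path_pattern:
  assumes ab: "X a0 b0" "X a0 b1" "\<not> X a0 b2" "X a1 b0" "\<not> X a1 b1" "X a1 b2"
      "\<not> X a2 b0" "X a2 b1" "\<not> X a2 b2"
    and c: "{c0, c1, c2} \<subseteq> V" "distinct [c0, c1, c2]" "p c1 = p c0" "p c2 = p c0"
      "p c0 \<notin> {p a0, p b0}"
  shows False
proof -
  have cV: "c \<in> V" "p c \<notin> {p a0, p b0}" if "c \<in> {c0, c1, c2}" for c
    using that c by auto
  have half: "X c a2 \<Longrightarrow> X c b0 \<and> X c b1" "X c a0 \<Longrightarrow> X c a1 \<Longrightarrow> X c b0"
    "X c a1 \<Longrightarrow> X c b1 \<Longrightarrow> X c a0 \<or> X c b0" "X c b2 \<Longrightarrow> X c a0 \<and> X c a1"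
    "X c b0 \<Longrightarrow> X c b1 \<Longrightarrow> X c a0" if "c \<in> {c0, c1, c2}" for c
  proof -
    have "X b0 a0" "X b0 a1" "\<not> X b0 a2" "X b1 a0" "\<not> X b1 a1" "X b1 a2"
      "\<not> X b2 a0" "X b2 a1" "\<not> X b2 a2" "p c \<notin> {p b0, p a0}"
      using ab across cV[OF that] by auto
    note dual = split_K33.path_half[OF permute(1) this(1-9) cV(1)[OF that] this(10)]
    show "X c a2 \<Longrightarrow> X c b0 \<and> X c b1" "X c a0 \<Longrightarrow> X c a1 \<Longrightarrow> X c b0"
      "X c a1 \<Longrightarrow> X c b1 \<Longrightarrow> X c a0 \<or> X c b0" "X c b2 \<Longrightarrow> X c a0 \<and> X c a1"
      "X c b0 \<Longrightarrow> X c b1 \<Longrightarrow> X c a0"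
      by (fact path_half[OF ab cV[OF that]] dual)+
  qed
  have pp: "c \<in> {c0, c1, c2}" "c' \<in> {c0, c1, c2}" "c \<noteq> c'" "p c = p c'"
    if "(c, c') \<in> {(c0, c1), (c0, c2), (c1, c2)}" for c c'
    using that c by auto
  have cn: "\<not> (X c u \<and> X c v \<and> X c' u \<and> X c' v)" "X c u \<or> X c v \<or> X c' u \<or> X c' v"
    if "(c, c') \<in> {(c0, c1), (c0, c2), (c1, c2)}"
      "(u, v) \<in> {(a0, a1), (a0, a2), (a1, a2), (b0, b1), (b0, b2), (b1, b2)}" for c c' u v
    using common_neighbours[OF cV(1)[OF pp(1)[OF that(1)]] cV(1)[OF pp(2)[OF that(1)]]
        pp(3,4)[OF that(1)] cV(2)[OF pp(1)[OF that(1)]], of u v] that(2) within neqs by auto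
  \<comment> \<open>Both pairs are \<open>X\<close>-edges, hence not
    \<open>Y\<close>-adjacent.\<close>
  have cross: "X c a2 \<or> X c b1 \<or> X c' a2 \<or> X c' b1" "X c b2 \<or> X c a1 \<or> X c' b2 \<or> X c' a1"
    if "(c, c') \<in> {(c0, c1), (c0, c2), (c1, c2)}" for c c'
    using common_neighbours(2)[OF cV(1)[OF pp(1)[OF that(1)]] cV(1)[OF pp(2)[OF that(1)]]
        pp(3,4)[OF that(1)] cV(2)[OF pp(1)[OF that(1)]]] ab across by auto
  \<comment> \<open>If the first claim failed, \<open>c, a1, b1, c', a2\<close> would be a chordless
    cycle of \<open>Y\<close>; the second exchanges \<open>c\<close> and \<open>c'\<close>.\<close>
  have five: "X c a1 \<or> \<not> X c b1 \<or> \<not> X c' a1 \<or> X c' b1 \<or> X c a2 \<or> X c' a2"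
    "X c' a1 \<or> \<not> X c' b1 \<or> \<not> X c a1 \<or> X c b1 \<or> X c a2 \<or> X c' a2"
    if cc: "(c, c') \<in> {(c0, c1), (c0, c2), (c1, c2)}" for c c'
  proof -
    note [simp] = within across neqs ab outside[OF cV[OF pp(1)[OF cc]]] outside[OF cV[OF pp(2)[OF cc]]]
    have [simp]: "\<not> Y c c'" "\<not> Y c' c"
      using same[OF cV(1)[OF pp(1)[OF cc]] cV(1)[OF pp(2)[OF cc]] pp(4,3)[OF cc]] sY[of c' c] by simp_all
    show "X c a1 \<or> \<not> X c b1 \<or> \<not> X c' a1 \<or> X c' b1 \<or> X c a2 \<or> X c' a2"
      using Y5[of c a1 b1 c' a2] by auto
    show "X c' a1 \<or> \<not> X c' b1 \<or> \<not> X c a1 \<or> X c b1 \<or> X c a2 \<or> X c' a2"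
      using Y5[of c' a1 b1 c a2] by auto
  qed
  \<comment> \<open>By \<open>cn\<close>, at most one of the three is \<open>X\<close>-adjacent to
    both \<open>b0\<close> and \<open>b1\<close>. By \<open>half\<close>, the other two are not
    adjacent to \<open>a2\<close>. Then \<open>cn\<close> and \<open>cross\<close> give
    \<open>a1\<close> and \<open>b1\<close> an \<open>X\<close>-neighbour among these two,
    \<open>five\<close> makes it the same vertex, and \<open>half\<close> adds \<open>a0\<close> and
    \<open>b0\<close> to its neighbours: a contradiction.\<close>
  show False
    using half[of c0, simplified] half[of c1, simplified] half[of c2, simplified]
      five[of c0 c1, simplified] five[of c0 c2, simplified] five[of c1 c2, simplified]
      cross[of c0 c1, simplified] cross[of c0 c2, simplified] cross[of c1 c2, simplified]
      cn[of c0 c1 a0 a1, simplified]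
      cn[of c0 c1 a0 a2, simplified]
      cn[of c0 c1 a1 a2, simplified]
      cn[of c0 c1 b0 b1, simplified]
      cn[of c0 c1 b0 b2, simplified]
      cn[of c0 c1 b1 b2, simplified]
      cn[of c0 c2 a0 a1, simplified]
      cn[of c0 c2 a0 a2, simplified]
      cn[of c0 c2 a1 a2, simplified]
      cn[of c0 c2 b0 b1, simplified]
      cn[of c0 c2 b0 b2, simplified]
      cn[of c0 c2 b1 b2, simplified]
      cn[of c1 c2 a0 a1, simplified]
      cn[of c1 c2 a0 a2, simplified]
      cn[of c1 c2 a1 a2, simplified]
      cn[of c1 c2 b0 b1, simplified]
      cn[of c1 c2 b0 b2, simplified]
      cn[of c1 c2 b1 b2, simplified]
    by argo
qed

text \<open>The \<open>X\<close>-neighbours of \<open>a2\<close> contain at most one \<open>b\<close>. All cases are one of the two patterns up to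
  symmetry; if \<open>a2\<close> has no \<open>X\<close>-neighbour, the first pattern occurs with \<open>X\<close> and \<open>Y\<close> exchanged.\<close>

lemma zigzag:
  assumes ab: "X a0 b0" "X a0 b1" "\<not> X a0 b2" "X a1 b0" "\<not> X a1 b1" "X a1 b2"
    and c: "{c0, c1, c2} \<subseteq> V" "distinct [c0, c1, c2]" "p c1 = p c0" "p c2 = p c0"
      "p c0 \<notin> {p a0, p b0}"
  shows False
proof -
  note [simp] = within across neqs ab parts
  have [simp]: "p c0 \<noteq> p b0" "p c0 \<noteq> p a0" "p b0 \<noteq> p a0"
    using c(5) parts(5) by force+
  \<comment> \<open>The last pair would close the \<open>X\<close>-path from \<open>b1\<close> to
    \<open>b2\<close> to a 6-cycle.\<close>
  have two: "\<not> (X a2 b0 \<and> X a2 b1)" "\<not> (X a2 b0 \<and> X a2 b2)" "\<not> (X a2 b1 \<and> X a2 b2)"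
    using X4[of a0 b0 a2 b1] X4[of a1 b0 a2 b2] X6[of a2 b1 a0 b0 a1 b2] by auto
  consider "X a2 b0" "\<not> X a2 b1" "\<not> X a2 b2" | "\<not> X a2 b0" "X a2 b1" "\<not> X a2 b2"
    | "\<not> X a2 b0" "\<not> X a2 b1" "X a2 b2" | "\<not> X a2 b0" "\<not> X a2 b1" "\<not> X a2 b2"
    using two by blast
  then show False
  proof cases
    case 1
    then show False
      using star_pattern[OF ab _ _ _ c] by blast
  next
    case 2
    then show False
      using path_pattern[OF ab _ _ _ c] by blast
  next
    case 3
    show False
      by (rule split_K33.path_pattern[OF permute(2) _ _ _ _ _ _ _ _ _ c(1-4)]) (use 3 in simp_all)
  next
    case 4
    \<comment> \<open>Here \<open>Y\<close> is the path \<open>a0, b2, a2, b1, a1\<close> with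
      \<open>b0\<close> attached to its centre \<open>a2\<close>.\<close>
    have "split_K33 V p Y X b2 b1 b0 a2 a0 a1"
      using split_K33_axioms unfolding split_K33_def by (auto simp: multipartite_split_swap)
    then show False
      by (rule split_K33.star_pattern[OF _ _ _ _ _ _ _ _ _ _ c(1-4)]) (use 4 in simp_all)
  qed
qed

text \<open>Two pairs among three \<open>b\<close>s share an element, and sharing both would give a
  4-cycle; so up to relabelling this is the situation of \<open>zigzag\<close>.\<close>

lemma majority:
  assumes "X a0 b0 \<and> X a0 b1 \<or> X a0 b0 \<and> X a0 b2 \<or> X a0 b1 \<and> X a0 b2"
    and "X a1 b0 \<and> X a1 b1 \<or> X a1 b0 \<and> X a1 b2 \<or> X a1 b1 \<and> X a1 b2"
    and c: "{c0, c1, c2} \<subseteq> V" "distinct [c0, c1, c2]" "p c1 = p c0" "p c2 = p c0"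
      "p c0 \<notin> {p a0, p b0}"
  shows False
proof -
  have zz: "\<not> (X a0 x \<and> X a0 y \<and> \<not> X a0 z \<and> X a1 x \<and> \<not> X a1 y \<and> X a1 z)"
    if "(x, y, z) \<in> {(b0, b1, b2), (b0, b2, b1), (b1, b0, b2), (b1, b2, b0), (b2, b0, b1), (b2, b1, b0)}"
    for x y z
  proof -
    have "split_K33 V p X Y a0 a1 a2 x y z"
      using split_K33_axioms that unfolding split_K33_def by auto
    moreover have "p c0 \<notin> {p a0, p x}"
      using c(5) parts that by auto
    ultimately show ?thesis
      using split_K33.zigzag[OF _ _ _ _ _ _ _ c(1-4)] by metis
  qed
  have "\<not> (X a0 x \<and> X a1 x \<and> X a0 y \<and> X a1 y)" if "(x, y) \<in> {(b0, b1), (b0, b2), (b1, b2)}" for x y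
    using that X4[of a0 x a1 y] within across neqs by auto
  note C4 = this[of b0 b1, simplified] this[of b0 b2, simplified] this[of b1 b2, simplified]
  show False
    using assms(1,2) C4 zz[of b0 b1 b2, simplified] zz[of b0 b2 b1, simplified] zz[of b1 b0 b2, simplified]
      zz[of b1 b2 b0, simplified] zz[of b2 b0 b1, simplified] zz[of b2 b1 b0, simplified]
    by argo
qed

end

text \<open>Each \<open>a\<close> sends at least two of its three edges to the \<open>b\<close>s
  into the same relation. Two of the three \<open>a\<close>s agree on that relation, and
  \<open>majority\<close> applies, after exchanging \<open>X\<close> and \<open>Y\<close> if
  necessary.\<close>

lemma no_split_K333:
  assumes split: "multipartite_split V p X Y"
    and V: "{a0, a1, a2} \<subseteq> V" "{b0, b1, b2} \<subseteq> V" "{c0, c1, c2} \<subseteq> V"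
    and distinct: "distinct [a0, a1, a2]" "distinct [b0, b1, b2]" "distinct [c0, c1, c2]"
    and parts: "p a1 = p a0" "p a2 = p a0" "p b1 = p b0" "p b2 = p b0" "p c1 = p c0" "p c2 = p c0"
      "distinct [p a0, p b0, p c0]"
  shows False
proof -
  define maj where "maj R a \<longleftrightarrow> R a b0 \<and> R a b1 \<or> R a b0 \<and> R a b2 \<or> R a b1 \<and> R a b2"
    for R :: "'a \<Rightarrow> 'a \<Rightarrow> bool" and a
  have K33: "split_K33 V p X Y a0 a1 a2 b0 b1 b2"
    using split V(1,2) distinct(1,2) parts by (auto simp: split_K33_def)
  have *: "\<not> (maj X x \<and> maj X y)" "\<not> (maj Y x \<and> maj Y y)"
    if "(x, y, z) \<in> {(a0, a1, a2), (a0, a2, a1), (a1, a2, a0)}" for x y z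
  proof -
    have "split_K33 V p X Y x y z b0 b1 b2" "split_K33 V p Y X x y z b0 b1 b2"
      using K33 that unfolding split_K33_def by (auto simp: multipartite_split_swap)
    note rows = this[THEN split_K33.majority, OF _ _ V(3) distinct(3) parts(5,6), folded maj_def]
    have "p c0 \<notin> {p x, p b0}"
      using parts that by auto
    then show "\<not> (maj X x \<and> maj X y)" "\<not> (maj Y x \<and> maj Y y)"
      using rows by blast+
  qed
  have "maj X a \<or> maj Y a" if "a \<in> {a0, a1, a2}" for a
    using split_K33.across(3)[OF K33 that] by (auto simp: maj_def)
  note this[of a0, simplified] this[of a1, simplified] this[of a2, simplified]
  then show False
    using *[of a0 a1 a2, simplified] *[of a0 a2 a1, simplified] *[of a1 a2 a0, simplified] by argo
qed

section \<open>Counting edges between two parts\<close>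

text \<open>Each overlapping pair is charged to its interval that starts later; the interval that starts
  first of all is never charged.\<close>

lemma overlap_count:
  assumes A: "finite A" "A \<noteq> {}" and B: "finite B"
    and dA: "\<And>a a'. a \<in> A \<Longrightarrow> a' \<in> A \<Longrightarrow> a \<noteq> a' \<Longrightarrow> \<not> overlap l r a a'"
    and dB: "\<And>b b'. b \<in> B \<Longrightarrow> b' \<in> B \<Longrightarrow> b \<noteq> b' \<Longrightarrow> \<not> overlap l r b b'"
  shows "card {(a, b) \<in> A \<times> B. overlap l r a b} < card A + card B"
proof -
  let ?E = "{(a, b) \<in> A \<times> B. overlap l r a b}"
  \<comment> \<open>Ties are charged to \<open>B\<close>, so the earliest \<open>a\<close> stays
    uncharged unless some \<open>b\<close> starts strictly before it. Two intervals charging the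
    same third one both cover the points just after its left end, so they would overlap; hence
    injectivity.\<close>
  define f where "f = (\<lambda>(a, b). if l a \<le> l b then Inr b else Inl a)"
  have inj: "inj_on f ?E"
  proof (rule inj_onI, clarify)
    fix a b a' b'
    assume *: "f (a, b) = f (a', b')" "a \<in> A" "b \<in> B" "a' \<in> A" "b' \<in> B"
      "overlap l r a b" "overlap l r a' b'"
    then show "a = a' \<and> b = b'"
      using dA[of a a'] dB[of b b'] by (auto simp: f_def overlap_def split: if_splits)
  qed
  have sub: "f ` ?E \<subseteq> A <+> B"
    by (auto simp: f_def)
  obtain v where v: "v \<in> A <+> B" "v \<notin> f ` ?E"
  proof -
    obtain a where a: "a \<in> A" "\<And>a'. a' \<in> A \<Longrightarrow> l a \<le> l a'"
      using arg_min_if_finite[OF A, of l] by (metis not_le)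
    show ?thesis
    proof (cases "\<exists>b\<in>B. l b < l a")
      case False
      then have "Inl a \<notin> f ` ?E"
        by (auto simp: f_def split: if_splits)
      then show ?thesis using that a by blast
    next
      case True
      then have ne: "B \<noteq> {}" by blast
      obtain b where b: "b \<in> B" "\<And>b'. b' \<in> B \<Longrightarrow> l b \<le> l b'"
        using arg_min_if_finite[OF B ne, of l] by (metis not_le)
      then have "l b < l a"
        using True by force
      then have "Inr b \<notin> f ` ?E"
        using a(2) by (force simp: f_def split: if_splits)
      then show ?thesis using that b by blast
    qed
  qed
  have "card ?E = card (f ` ?E)"
    by (rule card_image[OF inj, symmetric])
  also have "\<dots> < card (A <+> B)"
    using sub v A B by (intro psubset_card_mono) auto
  finally show ?thesis
    using A B by (simp add: card_Plus)
qed

text \<open>The sum of the bounds of \<open>overlap_count\<close> for \<open>X\<close> and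
  \<open>Y\<close>; each strict inequality contributes 1 to the summand 2.\<close>

lemma split_two_parts:
  assumes split: "multipartite_split V p X Y"
    and A: "finite A" "A \<noteq> {}" "A \<subseteq> V" "\<And>a. a \<in> A \<Longrightarrow> p a = \<alpha>"
    and B: "finite B" "B \<subseteq> V" "\<And>b. b \<in> B \<Longrightarrow> p b = \<beta>" "\<alpha> \<noteq> \<beta>"
  shows "card A * card B + 2 \<le> 2 * (card A + card B)"
proof -
  have count: "card {(a, b) \<in> A \<times> B. R a b} < card A + card B" if R_cases: "R = X \<or> R = Y" for R
  proof -
    have "interval_rel R"
      using split R_cases by (auto simp: multipartite_split_def)
    then obtain l r where R: "R = overlap l r"
      unfolding interval_rel_def by blast
    have "\<not> R u v" if "u \<in> V" "v \<in> V" "p u = p v" "u \<noteq> v" for u v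
      using split R_cases that by (auto simp: multipartite_split_def)
    then show ?thesis
      unfolding R using A B by (intro overlap_count) (auto simp: subset_iff)
  qed
  have "A \<times> B = {(a, b) \<in> A \<times> B. X a b} \<union> {(a, b) \<in> A \<times> B. Y a b}"
    using split A B unfolding multipartite_split_def by (fastforce simp: subset_iff)
  then have "card (A \<times> B) = card ({(a, b) \<in> A \<times> B. X a b} \<union> {(a, b) \<in> A \<times> B. Y a b})"
    by (rule arg_cong)
  also have "\<dots> \<le> card {(a, b) \<in> A \<times> B. X a b} + card {(a, b) \<in> A \<times> B. Y a b}"
    by (rule card_Un_le)
  finally have "card (A \<times> B) + 2 \<le> 2 * (card A + card B)"
    using count[OF disjI1[OF refl]] count[OF disjI2[OF refl]] by simp
  then show ?thesis
    by (simp only: card_cartesian_product)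
qed

section \<open>Rectangles\<close>

lemma open_intervals_meet:
  fixes a b c d :: real
  assumes "a < b" "c < d"
  shows "{a<..<b} \<inter> {c<..<d} \<noteq> {} \<longleftrightarrow> a < d \<and> c < b"
  using assms by auto

lemma interior_rectangle:
  "interior ({x1..x2} \<times> {y1..y2}) = {x1<..<x2} \<times> {y1<..<(y2 :: real)}" for x1 x2 :: real
  by (simp add: interior_Times)

lemma rectangles_meet:
  fixes x1 x2 y1 y2 :: "'v \<Rightarrow> real"
  assumes "x1 u < x2 u" "x1 v < x2 v" "y1 u < y2 u" "y1 v < y2 v"
  shows "interior ({x1 u..x2 u} \<times> {y1 u..y2 u}) \<inter> interior ({x1 v..x2 v} \<times> {y1 v..y2 v}) \<noteq> {}
    \<longleftrightarrow> overlap x1 x2 u v \<and> overlap y1 y2 u v"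
  by (simp only: interior_rectangle Times_Int_Times Times_empty de_Morgan_disj overlap_def
      open_intervals_meet[OF assms(1,2)] open_intervals_meet[OF assms(3,4)])

lemma sees_rectangles:
  fixes x1 x2 y1 y2 :: "'v \<Rightarrow> real"
  assumes "x1 u < x2 u" "x1 v < x2 v" "y1 u < y2 u" "y1 v < y2 v"
  shows "sees ({x1 u..x2 u} \<times> {y1 u..y2 u}) ({x1 v..x2 v} \<times> {y1 v..y2 v})
    \<longleftrightarrow> overlap x1 x2 u v \<or> overlap y1 y2 u v"
proof -
  let ?R = "{x1 u<..<x2 u} \<times> {y1 u<..<y2 u}" and ?S = "{x1 v<..<x2 v} \<times> {y1 v<..<y2 v}"
  have "(\<exists>c. {p. fst p = c} \<inter> ?R \<noteq> {} \<and> {p. fst p = c} \<inter> ?S \<noteq> {})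
      \<longleftrightarrow> {x1 u<..<x2 u} \<inter> {x1 v<..<x2 v} \<noteq> {}"
    \<comment> \<open>Density supplies the free second coordinate of a point on the line, in each
      rectangle.\<close>
    using dense[OF assms(3)] dense[OF assms(4)] by (fastforce simp: set_eq_iff)
  moreover have "(\<exists>c. {p. snd p = c} \<inter> ?R \<noteq> {} \<and> {p. snd p = c} \<inter> ?S \<noteq> {})
      \<longleftrightarrow> {y1 u<..<y2 u} \<inter> {y1 v<..<y2 v} \<noteq> {}"
    using dense[OF assms(1)] dense[OF assms(2)] by (fastforce simp: set_eq_iff)
  ultimately show ?thesis
    unfolding sees_def horizontal_line_def vertical_line_def interior_rectangle overlap_def
      open_intervals_meet[OF assms(1,2)] open_intervals_meet[OF assms(3,4)] by blast
qed

lemma trv_representation_cong: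
  "trv_representation G R \<Longrightarrow> (\<And>v. v \<in> pverts G \<Longrightarrow> R v = S v) \<Longrightarrow> trv_representation G S"
  unfolding trv_representation_def by simp

text \<open>Adjacency asks for an overlap in at least one projection and disjoint interiors forbid
  one in both, so different parts give exactly one. Within a part, nonadjacency forbids
  both.\<close>

lemma TRVG_complete_multipartite_iff:
  "TRVG (complete_multipartite k a) \<longleftrightarrow>
     (\<exists>x1 x2 y1 y2 :: nat \<times> nat \<Rightarrow> real.
        (\<forall>v \<in> (SIGMA i : {1..k}. {1..a i}). x1 v < x2 v \<and> y1 v < y2 v) \<and>
        multipartite_split (SIGMA i : {1..k}. {1..a i}) fst (overlap x1 x2) (overlap y1 y2))"
proof -
  let ?G = "complete_multipartite k a"
  define V where "V = (SIGMA i : {1..k}. {1..a i})"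
  have verts: "pverts ?G = V" and arcs: "(u, v) \<in> parcs ?G \<longleftrightarrow> u \<in> V \<and> v \<in> V \<and> fst u \<noteq> fst v" for u v
    by (simp_all add: complete_multipartite_def Let_def V_def)
  have rep: "trv_representation ?G (\<lambda>v. {x1 v..x2 v} \<times> {y1 v..y2 v}) \<longleftrightarrow>
      multipartite_split V fst (overlap x1 x2) (overlap y1 y2)"
    if "\<forall>v \<in> V. x1 v < x2 v \<and> y1 v < y2 v" for x1 x2 y1 y2 :: "nat \<times> nat \<Rightarrow> real"
  proof -
    have rect: "(\<forall>v \<in> V. axis_rectangle ({x1 v..x2 v} \<times> {y1 v..y2 v})) = True"
      using that unfolding axis_rectangle_def by blast
    have iv: "interval_rel (overlap x1 x2)" "interval_rel (overlap y1 y2)"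
      unfolding interval_rel_def by blast+
    have pair: "(interior ({x1 u..x2 u} \<times> {y1 u..y2 u}) \<inter> interior ({x1 v..x2 v} \<times> {y1 v..y2 v}) = {}) \<longleftrightarrow>
          \<not> (overlap x1 x2 u v \<and> overlap y1 y2 u v)"
        "sees ({x1 u..x2 u} \<times> {y1 u..y2 u}) ({x1 v..x2 v} \<times> {y1 v..y2 v}) \<longleftrightarrow>
          overlap x1 x2 u v \<or> overlap y1 y2 u v"
      if "u \<in> V" "v \<in> V" for u v
      using rectangles_meet[of x1 u x2 v y1 y2] sees_rectangles[of x1 u x2 v y1 y2]
        \<open>\<forall>v \<in> V. x1 v < x2 v \<and> y1 v < y2 v\<close> that by metis+
    let ?P = "\<lambda>u v. u \<noteq> v \<longrightarrow>
        interior ({x1 u..x2 u} \<times> {y1 u..y2 u}) \<inter> interior ({x1 v..x2 v} \<times> {y1 v..y2 v}) = {} \<and>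
        ((u, v) \<in> parcs ?G \<longleftrightarrow> sees ({x1 u..x2 u} \<times> {y1 u..y2 u}) ({x1 v..x2 v} \<times> {y1 v..y2 v}))"
    let ?Q = "\<lambda>u v. (fst u \<noteq> fst v \<longrightarrow> (overlap y1 y2 u v \<longleftrightarrow> \<not> overlap x1 x2 u v)) \<and>
        (u \<noteq> v \<and> fst u = fst v \<longrightarrow> \<not> overlap x1 x2 u v \<and> \<not> overlap y1 y2 u v)"
    have PQ: "?P u v \<longleftrightarrow> ?Q u v" if uv: "u \<in> V" "v \<in> V" for u v
      unfolding arcs pair[OF uv] using uv by (cases "fst u = fst v") (simp_all, blast+)
    have "trv_representation ?G (\<lambda>v. {x1 v..x2 v} \<times> {y1 v..y2 v}) \<longleftrightarrow> (\<forall>u\<in>V. \<forall>v\<in>V. ?P u v)"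
      by (simp only: trv_representation_def verts rect simp_thms ball_conj_distrib imp_conjR)
    also have "\<dots> \<longleftrightarrow> (\<forall>u\<in>V. \<forall>v\<in>V. ?Q u v)"
      by (intro ball_cong refl PQ)
    also have "\<dots> \<longleftrightarrow> multipartite_split V fst (overlap x1 x2) (overlap y1 y2)"
      by (simp only: multipartite_split_def iv simp_thms ball_conj_distrib)
    finally show ?thesis .
  qed
  show ?thesis
    unfolding V_def[symmetric]
  proof
    assume "TRVG ?G"
    then obtain R where R: "trv_representation ?G R"
      by (auto simp: TRVG_def)
    then have "\<forall>v \<in> V. axis_rectangle (R v)"
      unfolding trv_representation_def verts by (rule conjunct1)
    then obtain x1 x2 y1 y2 where
      xy: "\<forall>v \<in> V. x1 v < x2 v \<and> y1 v < y2 v \<and> R v = {x1 v..x2 v} \<times> {y1 v..y2 v}"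
      unfolding axis_rectangle_def by metis
    then have "trv_representation ?G (\<lambda>v. {x1 v..x2 v} \<times> {y1 v..y2 v})"
      using trv_representation_cong[OF R, of "\<lambda>v. {x1 v..x2 v} \<times> {y1 v..y2 v}"] verts by blast
    then have "multipartite_split V fst (overlap x1 x2) (overlap y1 y2)"
      using rep xy by blast
    then show "\<exists>x1 x2 y1 y2. (\<forall>v \<in> V. x1 v < x2 v \<and> y1 v < y2 v) \<and>
        multipartite_split V fst (overlap x1 x2) (overlap y1 y2)"
      using xy by blast
  next
    assume "\<exists>x1 x2 y1 y2. (\<forall>v \<in> V. x1 v < x2 v \<and> y1 v < y2 v) \<and>
        multipartite_split V fst (overlap x1 x2) (overlap y1 y2)"
    then show "TRVG ?G"
      using rep pair_graph_complete_multipartite unfolding TRVG_def by blast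
  qed
qed

section \<open>Constructing representations\<close>

text \<open>The two vertices of the \<open>i\<close>-th pair are the strips \<open>(-i, E) \<times> (-i - 1, -i)\<close> and
  \<open>(-i - 1, -i) \<times> (-i, E)\<close>. The first passes below and the second to the left of the square
  \<open>(0, E) \<times> (0, E)\<close> that contains all other rectangles.\<close>

lemma TRVG_add_pairs:
  fixes x1 x2 y1 y2 :: "nat \<times> nat \<Rightarrow> real"
  assumes pairs: "\<And>i. i \<in> {1..m} \<Longrightarrow> a i \<le> 2" and E: "0 < E"
    and box: "\<And>v. v \<in> (SIGMA i : {m<..k}. {1..a i}) \<Longrightarrow>
        0 \<le> x1 v \<and> x1 v < x2 v \<and> x2 v \<le> E \<and> 0 \<le> y1 v \<and> y1 v < y2 v \<and> y2 v \<le> E"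
    and split: "multipartite_split (SIGMA i : {m<..k}. {1..a i}) fst (overlap x1 x2) (overlap y1 y2)"
  shows "TRVG (complete_multipartite k a)"
proof -
  let ?V = "SIGMA i : {1..k}. {1..a i}" and ?W = "SIGMA i : {m<..k}. {1..a i}"
  define X1 where "X1 = (\<lambda>v :: nat \<times> nat.
    if fst v \<le> m then (if snd v = 1 then - real (fst v) else - real (fst v) - 1) else x1 v)"
  define X2 where "X2 = (\<lambda>v :: nat \<times> nat.
    if fst v \<le> m then (if snd v = 1 then E else - real (fst v)) else x2 v)"
  define Y1 where "Y1 = (\<lambda>v :: nat \<times> nat.
    if fst v \<le> m then (if snd v = 1 then - real (fst v) - 1 else - real (fst v)) else y1 v)"
  define Y2 where "Y2 = (\<lambda>v :: nat \<times> nat.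
    if fst v \<le> m then (if snd v = 1 then - real (fst v) else E) else y2 v)"
  note defs = X1_def X2_def Y1_def Y2_def
  have V: "v \<in> ?W \<or> fst v \<in> {1..m} \<and> snd v \<in> {1, 2}" if "v \<in> ?V" for v
    using that pairs[of "fst v"] by force
  have W: "m < fst v" "fst v \<noteq> 0" if "v \<in> ?W" for v
    using that by auto
  have inner: "fst u \<noteq> fst v \<Longrightarrow> overlap y1 y2 u v \<longleftrightarrow> \<not> overlap x1 x2 u v"
    "u \<noteq> v \<Longrightarrow> fst u = fst v \<Longrightarrow> \<not> overlap x1 x2 u v \<and> \<not> overlap y1 y2 u v"
    if "u \<in> ?W" "v \<in> ?W" for u v
    using split that unfolding multipartite_split_def by blast+
  have cross: "overlap Y1 Y2 u v \<longleftrightarrow> \<not> overlap X1 X2 u v"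
    if "u \<in> ?V" "v \<in> ?V" "fst u \<noteq> fst v" for u v
    using V[OF that(1)]
  proof
    assume u: "u \<in> ?W"
    show ?thesis using V[OF that(2)]
    proof
      assume "v \<in> ?W"
      then show ?thesis
        using inner(1)[OF u _ that(3)] W[OF u] W[of v] by (simp add: overlap_def defs)
    next
      assume "fst v \<in> {1..m} \<and> snd v \<in> {1, 2}"
      then show ?thesis
        using W[OF u] box[OF u] E by (auto simp: overlap_def defs)
    qed
  next
    assume u: "fst u \<in> {1..m} \<and> snd u \<in> {1, 2}"
    show ?thesis using V[OF that(2)]
    proof
      assume v: "v \<in> ?W"
      then show ?thesis
        using W[OF v] box[OF v] E u by (auto simp: overlap_def defs)
    next
      \<comment> \<open>Strips \<open>(i, 1)\<close> and \<open>(j, 2)\<close> overlap horizontally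
        if \<open>j < i\<close> and vertically if \<open>i < j\<close>; strips with equal second
        index overlap only along their long sides.\<close>
      assume "fst v \<in> {1..m} \<and> snd v \<in> {1, 2}"
      then show ?thesis
        using u that(3) E by (auto simp: overlap_def defs)
    qed
  qed
  have same: "\<not> overlap X1 X2 u v \<and> \<not> overlap Y1 Y2 u v"
    if "u \<in> ?V" "v \<in> ?V" "u \<noteq> v" "fst u = fst v" for u v
    using V[OF that(1)]
  proof
    assume u: "u \<in> ?W"
    then have "v \<in> ?W"
      using that by auto
    then show ?thesis
      using inner(2)[OF u _ that(3,4)] W[OF u] W[of v] by (simp add: overlap_def defs)
  next
    assume u: "fst u \<in> {1..m} \<and> snd u \<in> {1, 2}"
    moreover have "snd v \<in> {1, 2}" "snd u \<noteq> snd v"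
      using V[OF that(2)] W u that by (auto simp: prod_eq_iff)
    ultimately show ?thesis
      using that(4) by (auto simp: overlap_def defs)
  qed
  have nondegenerate: "X1 v < X2 v \<and> Y1 v < Y2 v" if "v \<in> ?V" for v
    using V[OF that] box[of v] W[of v] E by (auto simp: defs)
  show ?thesis
    unfolding TRVG_complete_multipartite_iff multipartite_split_def interval_rel_def
    using cross same nondegenerate by blast
qed

text \<open>The last part is a row of unit squares along the diagonal, so both axes use the same
  intervals.\<close>

lemma TRVG_pairs_and_one_part:
  assumes "k \<ge> 1" "\<And>i. i \<in> {1..k - 1} \<Longrightarrow> a i \<le> 2"
  shows "TRVG (complete_multipartite k a)"
proof -
  define x1 x2 :: "nat \<times> nat \<Rightarrow> real" where "x1 v = real (snd v)" and "x2 v = real (snd v) + 1" for v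
  have [simp]: "{k - Suc 0<..k} = {k}"
    using assms(1) by auto
  have "multipartite_split (SIGMA i : {k - 1<..k}. {1..a i}) fst (overlap x1 x2) (overlap x1 x2)"
    unfolding multipartite_split_def interval_rel_def
    using assms(1) by (auto simp: overlap_def x1_def x2_def)
  then show ?thesis
    using assms by (intro TRVG_add_pairs[where m = "k - 1" and E = "real (a k) + 1"])
      (auto simp: x1_def x2_def)
qed

text \<open>Let \<open>a\<^sub>j\<close> and \<open>b\<^sub>j\<close> be the vertices of the parts \<open>k - 1\<close> and \<open>k\<close>. The edges of
  \<open>K\<^sub>3\<^sub>,\<^sub>4\<close> are decomposed into the paths \<open>b\<^sub>1 a\<^sub>1 b\<^sub>2 a\<^sub>2 b\<^sub>3 a\<^sub>3 b\<^sub>4\<close> (horizontally) and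
  \<open>b\<^sub>3 a\<^sub>1 b\<^sub>4 a\<^sub>2 b\<^sub>1 a\<^sub>3 b\<^sub>2\<close> (vertically).\<close>

lemma TRVG_pairs_and_K34:
  assumes "k \<ge> 2" "\<And>i. i \<in> {1..k - 2} \<Longrightarrow> a i \<le> 2" "a (k - 1) \<le> 3" "a k \<le> 4"
  shows "TRVG (complete_multipartite k a)"
proof -
  \<comment> \<open>Intervals follow the order of each path, and consecutive ones overlap in length
    1: horizontally length 2 at step 1 from 1, vertically length 3 at step 2 from 0. The vertical
    path ends at 15, the box size used below.\<close>
  define x1 x2 y1 y2 :: "nat \<times> nat \<Rightarrow> real" where
    "x1 v = 2 * real (snd v) + (if fst v = k then - 1 else 0)" and
    "x2 v = 2 * real (snd v) + (if fst v = k then 1 else 2)" and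
    "y1 v = 4 * real (snd v) + (if fst v = k then if snd v \<le> 2 then 4 else - 12 else - 2)" and
    "y2 v = 4 * real (snd v) + (if fst v = k then if snd v \<le> 2 then 7 else - 9 else 1)" for v
  note defs = x1_def x2_def y1_def y2_def
  let ?K = "{(k - 1, 1), (k - 1, 2), (k - 1, 3), (k, 1), (k, 2), (k, 3), (k, 4)}"
  have sub: "(SIGMA i : {k - 2<..k}. {1..a i}) \<subseteq> ?K"
  proof
    fix v assume "v \<in> (SIGMA i : {k - 2<..k}. {1..a i})"
    then obtain i j where v: "v = (i, j)" "k - 2 < i" "i \<le> k" "1 \<le> j" "j \<le> a i"
      by auto
    then have "i = k - 1 \<or> i = k"
      by linarith
    then have "i = k - 1 \<and> (j = 1 \<or> j = 2 \<or> j = 3) \<or> i = k \<and> (j = 1 \<or> j = 2 \<or> j = 3 \<or> j = 4)"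
      using v assms(3,4) by auto
    then show "v \<in> ?K"
      using v(1) by auto
  qed
  have [simp]: "k - Suc 0 \<noteq> k" "k \<noteq> k - Suc 0"
    using assms(1) by auto
  have "multipartite_split ?K fst (overlap x1 x2) (overlap y1 y2)"
    unfolding multipartite_split_def interval_rel_def by (auto simp: overlap_def defs)
  note split = multipartite_split_mono[OF this sub]
  have box: "0 \<le> x1 v \<and> x1 v < x2 v \<and> x2 v \<le> 15 \<and> 0 \<le> y1 v \<and> y1 v < y2 v \<and> y2 v \<le> 15"
    if "v \<in> (SIGMA i : {k - 2<..k}. {1..a i})" for v
    using subsetD[OF sub that] by (auto simp: defs)
  show ?thesis
    by (rule TRVG_add_pairs[OF assms(2) _ box split]) simp_all
qed

theorem theorem3:
  fixes k :: nat and a :: "nat \<Rightarrow> nat"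
  assumes "k \<ge> 3"
    and "\<And>i. i \<in> {1..k} \<Longrightarrow> a i > 0"
    and "mono_on {1..k} a"
  shows "TRVG (complete_multipartite k a) \<longleftrightarrow>
           a (k - 1) \<le> 2 \<or>
           (a (k - 2), a (k - 1), a k) \<in> {(1, 3, 3), (1, 3, 4), (2, 3, 3), (2, 3, 4)}"
proof
  have mono: "a i \<le> a j" if "1 \<le> i" "i \<le> j" "j \<le> k" for i j
    using assms(3) that by (auto simp: mono_on_def)
  {
    assume "TRVG (complete_multipartite k a)"
    then obtain X Y where
      split: "multipartite_split (SIGMA i : {1..k}. {1..a i}) fst X Y"
      unfolding TRVG_complete_multipartite_iff by blast
    show "a (k - 1) \<le> 2 \<or>
        (a (k - 2), a (k - 1), a k) \<in> {(1, 3, 3), (1, 3, 4), (2, 3, 3), (2, 3, 4)}"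
    proof (rule ccontr)
      assume neg: "\<not> ?thesis"
      then have "3 \<le> a (k - 1)" "a (k - 1) \<le> a k"
        using mono[of "k - 1" k] assms(1) by auto
      have "card ({k - 1} \<times> {1..a (k - 1)}) * card ({k} \<times> {1..a k}) + 2
          \<le> 2 * (card ({k - 1} \<times> {1..a (k - 1)}) + card ({k} \<times> {1..a k}))"
        using assms(1) \<open>3 \<le> a (k - 1)\<close>
        by (intro split_two_parts[OF split, where \<alpha> = "k - 1" and \<beta> = k]) auto
      then have "a (k - 1) * a k + 2 \<le> 2 * (a (k - 1) + a k)"
        by (simp add: card_cartesian_product)
      have "a (k - 1) < 4"
      proof (rule ccontr)
        assume "\<not> a (k - 1) < 4"
        then have "4 * a k \<le> a (k - 1) * a k"
          by simp
        then have "4 * a k + 2 \<le> a (k - 1) * a k + 2"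
          by simp
        also have "\<dots> \<le> 2 * (a (k - 1) + a k)"
          by fact
        finally show False
          using \<open>a (k - 1) \<le> a k\<close> by simp
      qed
      then have "a (k - 1) = 3"
        using \<open>3 \<le> a (k - 1)\<close> by linarith
      moreover have "a k \<le> 4"
        using \<open>a (k - 1) * a k + 2 \<le> 2 * (a (k - 1) + a k)\<close> unfolding \<open>a (k - 1) = 3\<close> by simp
      moreover have "0 < a (k - 2)"
        using assms(1,2) by simp
      \<comment> \<open>Since \<open>a (k - 1) = 3\<close> and \<open>a k\<close> is 3 or 4,
        \<open>neg\<close> rules out the values 1 and 2.\<close>
      ultimately have "3 \<le> a (k - 2)"
        using neg \<open>a (k - 1) \<le> a k\<close> by auto
      moreover have "1 \<le> k - 2" "1 \<le> k - 1" "k - 2 \<noteq> k - 1" "k - 2 \<noteq> k" "k - 1 \<noteq> k"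
        using assms(1) by auto
      ultimately show False
        using no_split_K333[OF split, of "(k - 2, 1)" "(k - 2, 2)" "(k - 2, 3)" "(k - 1, 1)" "(k - 1, 2)"
            "(k - 1, 3)" "(k, 1)" "(k, 2)" "(k, 3)"] assms(1) \<open>3 \<le> a (k - 1)\<close> \<open>a (k - 1) \<le> a k\<close>
        by auto
    qed
  }
  assume "a (k - 1) \<le> 2 \<or>
      (a (k - 2), a (k - 1), a k) \<in> {(1, 3, 3), (1, 3, 4), (2, 3, 3), (2, 3, 4)}"
  then show "TRVG (complete_multipartite k a)"
  proof
    assume "a (k - 1) \<le> 2"
    then have "a i \<le> 2" if "i \<in> {1..k - 1}" for i
      using mono[of i "k - 1"] that by force
    then show ?thesis
      using assms(1) by (intro TRVG_pairs_and_one_part) auto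
  next
    assume *: "(a (k - 2), a (k - 1), a k) \<in> {(1, 3, 3), (1, 3, 4), (2, 3, 3), (2, 3, 4)}"
    then have "a i \<le> 2" if "i \<in> {1..k - 2}" for i
      using mono[of i "k - 2"] that by force
    then show ?thesis
      using assms(1) * by (intro TRVG_pairs_and_K34) auto
  qed
qed

end
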